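(* Let $\mathcal{A}$ be a Rickart *-ring. Then each of the binary relations $\preceq^{*|\ell\square}$, $\preceq^{*|r\square}$ and $\preceq^{*|\square}$ on $\mathcal{A}$, defined for $a,b\in\mathcal{A}$ by - $a\preceq^{*|\ell\square} b$ iff $\mathrm{lp}(a)b=a=b\,\mathrm{rp}(a)$ and $a^2=ab$, - $a\preceq^{*|r\square} b$ iff $\mathrm{lp}(a)b=a=b\,\mathrm{rp}(a)$ and $a^2=ba$, - $a\preceq^{*|\square} b$ iff $\mathrm{lp}(a)b=a=b\,\mathrm{rp}(a)$ and $a^2=ab=ba$, is a partial order on $\mathcal{A}$.
   Context: A *-ring is an (associative) ring $\mathcal{A}$ with an involution $*$: $(a+b)^*=a^*+b^*$, $(ab)^*=b^*a^*$, $(a^* )^*=a$. It is a Rickart *-ring if for every $a\in\mathcal{A}$ there is a self-adjoint idempotent $p$ (i.e. $p=p^*=p^2$) with $\{x\in\mathcal{A}: xa=0\}=\mathcal{A}(1-p)$; such a ring has an identity $1$, and $p$ is unique and denoted $\mathrm{lp}(a)$. Likewise, for every $a$ there is a unique self-adjoint idempotent $\mathrm{rp}(a)$ with $\{x\in\mathcal{A}: ax=0\}=(1-\mathrm{rp}(a))\mathcal{A}$. *)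

theory Defs
  imports Main
begin

class star_ring = ring +
  fixes star :: "'a \<Rightarrow> 'a"
  assumes star_add: "star (a + b) = star a + star b"
    and star_mult: "star (a * b) = star b * star a"
    and star_star: "star (star a) = a"

definition self_adjoint_idempotent :: "'a::star_ring \<Rightarrow> bool" where
  "self_adjoint_idempotent p \<longleftrightarrow> p = star p \<and> p = p * p"

text \<open>The identity comes from \<^class>\<open>monoid_mult\<close> rather than \<^class>\<open>ring_1\<close>, so that the zero ring
  is not excluded.\<close>

class rickart_star_ring = star_ring + monoid_mult +
  assumes rickart: "\<exists>p. (p = star p \<and> p = p * p) \<and> {x. x * a = 0} = {x * (1 - p) | x. True}"

definition lp :: "'a::rickart_star_ring \<Rightarrow> 'a" where
  "lp a = (THE p. self_adjoint_idempotent p \<and> {x. x * a = 0} = {x * (1 - p) | x. True})"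

definition rp :: "'a::rickart_star_ring \<Rightarrow> 'a" where
  "rp a = (THE p. self_adjoint_idempotent p \<and> {x. a * x = 0} = {(1 - p) * x | x. True})"

definition star_left_square_le :: "'a::rickart_star_ring \<Rightarrow> 'a \<Rightarrow> bool" where
  "star_left_square_le a b \<longleftrightarrow> lp a * b = a \<and> a = b * rp a \<and> a ^ 2 = a * b"

definition star_right_square_le :: "'a::rickart_star_ring \<Rightarrow> 'a \<Rightarrow> bool" where
  "star_right_square_le a b \<longleftrightarrow> lp a * b = a \<and> a = b * rp a \<and> a ^ 2 = b * a"

definition star_square_le :: "'a::rickart_star_ring \<Rightarrow> 'a \<Rightarrow> bool" where
  "star_square_le a b \<longleftrightarrow> lp a * b = a \<and> a = b * rp a \<and> a ^ 2 = a * b \<and> a * b = b * a"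

text \<open>The descriptions defining \<^const>\<open>lp\<close> and \<^const>\<open>rp\<close> are uniquely satisfied.\<close>

lemma star_one: "star 1 = (1::'a::rickart_star_ring)"
  by (metis mult_1_left mult_1_right star_mult star_star)

lemma star_zero: "star 0 = (0::'a::star_ring)"
  by (metis add_cancel_right_right star_add)

lemma star_diff: "star (a - b) = star a - star (b::'a::star_ring)"
  by (metis add_diff_cancel diff_add_cancel star_add)

lemma absorbing_projections_eq:
  fixes p q :: "'a::rickart_star_ring"
  assumes "self_adjoint_idempotent p" "self_adjoint_idempotent q" "p * q = q" "q * p = p"
  shows "p = q"
  using assms unfolding self_adjoint_idempotent_def by (metis star_mult)

lemma lp_mult_eq:
  fixes p q :: "'a::rickart_star_ring"
  assumes "self_adjoint_idempotent q"
    and "{x * (1 - p) | x. True} = {x * (1 - q) | x. True}"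
  shows "p * q = q"
proof -
  have "1 * (1 - p) \<in> {x * (1 - q) | x. True}"
    using assms(2) by blast
  then obtain y where y: "1 - p = y * (1 - q)"
    by auto
  have "(1 - p) * q = y * (q - q * q)"
    unfolding y by (simp add: mult.assoc left_diff_distrib)
  also have "\<dots> = 0"
    using assms(1) unfolding self_adjoint_idempotent_def by simp
  finally show ?thesis
    by (simp add: left_diff_distrib)
qed

lemma ex1_lp:
  fixes a :: "'a::rickart_star_ring"
  shows "\<exists>!p. self_adjoint_idempotent p \<and> {x. x * a = 0} = {x * (1 - p) | x. True}"
proof (rule ex_ex1I)
  show "\<exists>p. self_adjoint_idempotent p \<and> {x. x * a = 0} = {x * (1 - p) | x. True}"
    using rickart[of a] unfolding self_adjoint_idempotent_def by simp
  show "p = q"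
    if "self_adjoint_idempotent p \<and> {x. x * a = 0} = {x * (1 - p) | x. True}"
      and "self_adjoint_idempotent q \<and> {x. x * a = 0} = {x * (1 - q) | x. True}" for p q
  proof (rule absorbing_projections_eq)
    show "p * q = q" "q * p = p"
      using that by (auto intro!: lp_mult_eq)
  qed (use that in blast)+
qed

lemma right_annihilator_iff:
  fixes a p :: "'a::rickart_star_ring"
  assumes "self_adjoint_idempotent p"
  shows "{x. a * x = 0} = {(1 - p) * x | x. True} \<longleftrightarrow>
    {x. x * star a = 0} = {x * (1 - p) | x. True}"
proof -
  have sp: "star (1 - p) = 1 - p"
    using assms by (simp add: star_diff star_one self_adjoint_idempotent_def)
  have 1: "x * star a = 0 \<longleftrightarrow> a * star x = 0" for x
    by (metis star_mult star_star star_zero)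
  have 2: "(\<exists>y. x = y * (1 - p)) \<longleftrightarrow> (\<exists>y. star x = (1 - p) * y)" for x
    by (metis sp star_mult star_star)
  have "{x. a * x = 0} = {(1 - p) * x | x. True} \<longleftrightarrow>
      (\<forall>x. a * x = 0 \<longleftrightarrow> (\<exists>y. x = (1 - p) * y))"
    by auto
  also have "\<dots> \<longleftrightarrow> (\<forall>x. a * star x = 0 \<longleftrightarrow> (\<exists>y. star x = (1 - p) * y))"
    by (metis star_star)
  also have "\<dots> \<longleftrightarrow> {x. x * star a = 0} = {x * (1 - p) | x. True}"
    unfolding 1[symmetric] 2[symmetric] by auto
  finally show ?thesis .
qed

lemma ex1_rp:
  fixes a :: "'a::rickart_star_ring"
  shows "\<exists>!p. self_adjoint_idempotent p \<and> {x. a * x = 0} = {(1 - p) * x | x. True}"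
proof -
  have "self_adjoint_idempotent p \<and> {x. a * x = 0} = {(1 - p) * x | x. True} \<longleftrightarrow>
      self_adjoint_idempotent p \<and> {x. x * star a = 0} = {x * (1 - p) | x. True}" for p
    by (rule conj_cong[OF refl right_annihilator_iff])
  then show ?thesis
    by (simp only: ex1_lp)
qed

end

(* Idea: the condition lp(a)b = a = b rp(a) alone is the star order.  It is a partial order since
   a = b rp(a) forces lp(b)a = a, so that lp(a) <= lp(b) as projections, and dually for rp.  The
   square conditions are transitive because a is a left multiple of b on one side and a right
   multiple on the other: if bc = b^2 then ac = lp(a)bc = lp(a)b^2 = ab. *)

theory Submission
  imports Defs
begin

context
  fixes a :: "'a::rickart_star_ring"
begin

lemma self_adjoint_idempotent_lp: "self_adjoint_idempotent (lp a)"
  and lp_annihilator: "{x. x * a = 0} = {x * (1 - lp a) | x. True}"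
  using theI'[OF ex1_lp[of a]] unfolding lp_def by blast+

lemma self_adjoint_idempotent_rp: "self_adjoint_idempotent (rp a)"
  and rp_annihilator: "{x. a * x = 0} = {(1 - rp a) * x | x. True}"
  using theI'[OF ex1_rp[of a]] unfolding rp_def by blast+

text \<open>Both sides say that \<open>x\<close> lies in the left ideal generated by
  \<open>1 - lp a\<close>: it annihilates \<open>a\<close> by the choice of \<open>lp a\<close>, and
  \<open>lp a\<close> because that is idempotent.\<close>

lemma mult_eq_0_iff_lp: "x * a = 0 \<longleftrightarrow> x * lp a = 0"
proof
  assume "x * a = 0"
  then obtain y where "x = y * (1 - lp a)"
    using lp_annihilator by blast
  moreover have "(1 - lp a) * lp a = 0"
    using self_adjoint_idempotent_lp by (simp add: self_adjoint_idempotent_def left_diff_distrib)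
  ultimately show "x * lp a = 0"
    by (simp add: mult.assoc)
next
  assume "x * lp a = 0"
  then have "x = x * (1 - lp a)"
    by (simp add: right_diff_distrib)
  then show "x * a = 0"
    using lp_annihilator by blast
qed

lemma mult_eq_0_iff_rp: "a * x = 0 \<longleftrightarrow> rp a * x = 0"
proof
  assume "a * x = 0"
  then obtain y where "x = (1 - rp a) * y"
    using rp_annihilator by blast
  moreover have "rp a * (1 - rp a) = 0"
    using self_adjoint_idempotent_rp by (simp add: self_adjoint_idempotent_def right_diff_distrib)
  ultimately show "rp a * x = 0"
    by (simp flip: mult.assoc)
next
  assume "rp a * x = 0"
  then have "x = (1 - rp a) * x"
    by (simp add: left_diff_distrib)
  then show "a * x = 0"
    using rp_annihilator by blast
qed

text \<open>Equal left annihilators, applied to \<open>x - 1\<close>. This turns absorption of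
  \<open>a\<close> into absorption of its projection.\<close>

lemma mult_eq_self_iff_lp: "x * a = a \<longleftrightarrow> x * lp a = lp a"
  using mult_eq_0_iff_lp[of "x - 1"] by (simp add: left_diff_distrib)

lemma mult_eq_self_iff_rp: "a * x = a \<longleftrightarrow> rp a * x = rp a"
  using mult_eq_0_iff_rp[of "x - 1"] by (simp add: right_diff_distrib)

lemma lp_mult_self: "lp a * a = a"
  using self_adjoint_idempotent_lp
  by (simp add: mult_eq_self_iff_lp self_adjoint_idempotent_def)

lemma mult_rp_self: "a * rp a = a"
  using self_adjoint_idempotent_rp
  by (simp add: mult_eq_self_iff_rp self_adjoint_idempotent_def)

end

text \<open>The involution fixes both projections and reverses products, so it exchanges the two
  equations; each expresses that \<open>q\<close> lies below \<open>p\<close> in the order of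
  projections.\<close>

lemma self_adjoint_idempotent_absorb_commute:
  fixes p q :: "'a::star_ring"
  assumes "self_adjoint_idempotent p" "self_adjoint_idempotent q"
  shows "p * q = q \<longleftrightarrow> q * p = q"
  using assms unfolding self_adjoint_idempotent_def by (metis star_mult)

definition star_le :: "'a::rickart_star_ring \<Rightarrow> 'a \<Rightarrow> bool" where
  "star_le a b \<longleftrightarrow> lp a * b = a \<and> a = b * rp a"

lemma star_le_refl: "star_le a a"
  by (simp add: star_le_def lp_mult_self mult_rp_self)

text \<open>Here \<open>a\<close> is a right multiple of \<open>b\<close>, and \<open>lp b\<close>
  is a left identity for \<open>b\<close>.\<close>

lemma star_le_lp_mult:
  assumes "star_le a b"
  shows "lp b * a = a"
  using assms unfolding star_le_def by (metis lp_mult_self mult.assoc)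

lemma star_le_mult_rp:
  assumes "star_le a b"
  shows "a * rp b = a"
  using assms unfolding star_le_def by (metis mult_rp_self mult.assoc)

text \<open>The product \<open>lp b * a\<close> equals \<open>a\<close> by the first assumption and
  \<open>b\<close> by the second.\<close>

lemma star_le_antisym:
  assumes "star_le a b" "star_le b a"
  shows "a = b"
  using star_le_lp_mult[OF assms(1)] assms(2) by (simp add: star_le_def)

lemma star_le_trans:
  assumes ab: "star_le a b" and bc: "star_le b c"
  shows "star_le a c"
proof -
  \<comment> \<open>From \<open>lp b * a = a\<close> comes \<open>lp b * lp a = lp a\<close>; the
    involution flips it, so that \<open>lp b\<close> can be inserted between \<open>lp a\<close> and
    \<open>c\<close>, where \<open>lp b * c = b\<close>.\<close>
  have "lp a * lp b = lp a"
    using star_le_lp_mult[OF ab] self_adjoint_idempotent_absorb_commute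
      self_adjoint_idempotent_lp mult_eq_self_iff_lp by blast
  then have "lp a * c = lp a * b"
    using bc by (metis star_le_def mult.assoc)
  moreover have "rp b * rp a = rp a"
    using star_le_mult_rp[OF ab] self_adjoint_idempotent_absorb_commute
      self_adjoint_idempotent_rp mult_eq_self_iff_rp by blast
  then have "c * rp a = b * rp a"
    using bc by (metis star_le_def mult.assoc)
  ultimately show ?thesis
    using ab by (simp add: star_le_def)
qed

lemma star_le_mult_right_trans:
  assumes "star_le a b" "b ^ 2 = b * c"
  shows "a * c = a * b"
  using assms unfolding star_le_def power2_eq_square by (metis mult.assoc)

text \<open>Mirror computation through the right projection:
  \<open>c * a = c * b * rp a = b * b * rp a = b * a\<close>.\<close>

lemma star_le_mult_left_trans:
  assumes "star_le a b" "b ^ 2 = c * b"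
  shows "c * a = b * a"
  using assms unfolding star_le_def power2_eq_square by (metis mult.assoc)

lemma star_left_square_le_iff: "star_left_square_le a b \<longleftrightarrow> star_le a b \<and> a ^ 2 = a * b"
  by (simp add: star_left_square_le_def star_le_def)

lemma star_right_square_le_iff: "star_right_square_le a b \<longleftrightarrow> star_le a b \<and> a ^ 2 = b * a"
  by (simp add: star_right_square_le_def star_le_def)

text \<open>As an intersection of the two one-sided relations, this one inherits reflexivity and
  transitivity from them.\<close>

lemma star_square_le_iff:
  "star_square_le a b \<longleftrightarrow> star_left_square_le a b \<and> star_right_square_le a b"
  by (auto simp: star_square_le_def star_left_square_le_def star_right_square_le_def)

lemma star_left_square_le_refl: "star_left_square_le a a"
  by (simp add: star_left_square_le_iff star_le_refl power2_eq_square)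

lemma star_right_square_le_refl: "star_right_square_le a a"
  by (simp add: star_right_square_le_iff star_le_refl power2_eq_square)

lemma star_left_square_le_trans:
  "star_left_square_le a b \<Longrightarrow> star_left_square_le b c \<Longrightarrow> star_left_square_le a c"
  unfolding star_left_square_le_iff by (metis star_le_trans star_le_mult_right_trans)

lemma star_right_square_le_trans:
  "star_right_square_le a b \<Longrightarrow> star_right_square_le b c \<Longrightarrow> star_right_square_le a c"
  unfolding star_right_square_le_iff by (metis star_le_trans star_le_mult_left_trans)

text \<open>Antisymmetry passes to any relation contained in the star order, so only reflexivity and
  transitivity remain to be supplied.\<close>

lemma partial_order_on_UNIV_if_star_le:
  assumes "\<And>a. R a a"
    and "\<And>a b c. R a b \<Longrightarrow> R b c \<Longrightarrow> R a c"
    and "\<And>a b. R a b \<Longrightarrow> star_le a b"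
  shows "partial_order_on UNIV {(a, b). R a b}"
  unfolding partial_order_on_def preorder_on_def
  by (auto intro!: refl_onI transI antisymI intro: assms star_le_antisym)

theorem theorem11:
  "partial_order_on UNIV {(a :: 'a::rickart_star_ring, b). star_left_square_le a b} \<and>
   partial_order_on UNIV {(a :: 'a, b). star_right_square_le a b} \<and>
   partial_order_on UNIV {(a :: 'a, b). star_square_le a b}"
proof (intro conjI; rule partial_order_on_UNIV_if_star_le)
\<comment> \<open>The one-sided relations stay folded, so that their reflexivity and transitivity
  rules apply; the \<open>iffD1\<close> forms act as conditional rewrites that settle the goals
  \<open>star_le a b\<close>.\<close>
qed (auto simp: star_square_le_iff star_left_square_le_iff[THEN iffD1]
      star_right_square_le_iff[THEN iffD1] star_left_square_le_refl star_right_square_le_refl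
    intro: star_left_square_le_trans star_right_square_le_trans)

end
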